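(* Let $(X,f_{1,\infty})$ be an NDS and $n\in\mathbb{N}$. Then $f_{1,\infty}$ is multi-transitive if and only if its $n$-th iterate $f_{1,\infty}^{[n]}$ is multi-transitive.
   Context: $\mathbb{N}=\{1,2,3,\dots\}$. A non-autonomous discrete dynamical system (NDS) $(X,f_{1,\infty})$ consists of a compact metric space $(X,d)$ and a sequence $f_{1,\infty}=\{f_n\}_{n=1}^\infty$ of continuous maps $f_n:X\to X$. For $i,n\in\mathbb{N}$, $f_i^n:=f_{i+(n-1)}\circ\cdots\circ f_i$, and $f_i^0=\mathrm{id}_X$. For $k\in\mathbb{N}$, the $k$-th iterate of the NDS is the NDS on $X$ given by the sequence $f_{1,\infty}^{[k]}:=\{f_{k(n-1)+1}^k\}_{n=1}^\infty$ (so the composition of its first $n$ maps is $f_1^{kn}$). The NDS is multi-transitive if for any $m\in\mathbb{N}$ and any nonempty open subsets $U_1,\dots,U_m,V_1,\dots,V_m$ of $X$ there exists $l\in\mathbb{N}$ such that $f_1^{il}(U_i)\cap V_i\neq\emptyset$ for each $i\in\{1,\dots,m\}$ (equivalently, $f_{1,\infty}\times f_{1,\infty}^{[2]}\times\cdots\times f_{1,\infty}^{[m]}$ is transitive on $X^m$ for every $m\in\mathbb{N}$). *)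

theory Defs
  imports "HOL-Analysis.Analysis"
begin

(* The maps are indexed from 1; the value f 0 is never used. *)
locale nds = Metric_space X d for X :: "'a set" and d :: "'a \<Rightarrow> 'a \<Rightarrow> real" +
  fixes f :: "nat \<Rightarrow> 'a \<Rightarrow> 'a"
  assumes compact: "compact_space mtopology"
    and continuous: "\<And>n. n \<ge> 1 \<Longrightarrow> continuous_map mtopology mtopology (f n)"

(* nds_comp f i n is f_i^n, the composition of the n maps f_i, ..., f_{i+n-1} (f_i applied first). *)
primrec nds_comp :: "(nat \<Rightarrow> 'a \<Rightarrow> 'a) \<Rightarrow> nat \<Rightarrow> nat \<Rightarrow> 'a \<Rightarrow> 'a" where
  "nds_comp f i 0 = id"
| "nds_comp f i (Suc n) = f (i + n) \<circ> nds_comp f i n"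

(* Meaningful for n >= 1 only; at n = 0 the natural-number subtraction truncates. *)
definition nds_iterate :: "(nat \<Rightarrow> 'a \<Rightarrow> 'a) \<Rightarrow> nat \<Rightarrow> nat \<Rightarrow> 'a \<Rightarrow> 'a" where
  "nds_iterate f k = (\<lambda>n. nds_comp f (k * (n - 1) + 1) k)"

definition multi_transitive :: "'a topology \<Rightarrow> (nat \<Rightarrow> 'a \<Rightarrow> 'a) \<Rightarrow> bool" where
  "multi_transitive T f \<longleftrightarrow>
    (\<forall>m\<ge>1. \<forall>U V :: nat \<Rightarrow> 'a set.
      (\<forall>i\<in>{1..m}. openin T (U i) \<and> U i \<noteq> {} \<and> openin T (V i) \<and> V i \<noteq> {}) \<longrightarrow>
      (\<exists>l\<ge>1. \<forall>i\<in>{1..m}. nds_comp f 1 (i * l) ` U i \<inter> V i \<noteq> {}))"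

lemma nds_comp_add: "nds_comp f i (m + n) = nds_comp f (i + m) n \<circ> nds_comp f i m"
  by (induction n) (auto simp: fun_eq_iff add.assoc)

lemma nds_comp_iterate: "nds_comp (nds_iterate f k) 1 n = nds_comp f 1 (k * n)"
proof (induction n)
  case (Suc n)
  have "nds_comp f 1 (k * n + k) = nds_comp f (1 + k * n) k \<circ> nds_comp f 1 (k * n)"
    by (rule nds_comp_add)
  with Suc show ?case
    by (simp add: nds_iterate_def add.commute)
qed simp

context nds
begin

lemma continuous_map_nds_comp:
  assumes "i \<ge> 1"
  shows "continuous_map mtopology mtopology (nds_comp f i n)"
proof (induction n)
  case 0
  show ?case by (simp add: continuous_map_id)
next
  case (Suc n)
  from continuous_map_compose[OF Suc continuous[of "i + n"]] assms show ?case
    by (simp add: o_def)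
qed

lemma nds_nds_iterate: "nds X d (nds_iterate f k)"
  by unfold_locales (simp_all add: compact nds_iterate_def continuous_map_nds_comp)

end

end

(* Since the composition of the first l maps of the n-th iterate is f_1^{nl}, a time l for the n-th
   iterate is the time nl for f. Conversely, given m pairs for the n-th iterate, assign the pair i to
   the index ni; a time for the resulting mn pairs with respect to f serves for the n-th iterate. *)
theory Submission
  imports Defs
begin

lemma multi_transitive_nds_iterateI:
  fixes f :: "nat \<Rightarrow> 'a \<Rightarrow> 'a"
  assumes "multi_transitive T f" and n: "n \<ge> 1"
  shows "multi_transitive T (nds_iterate f n)"
  \<comment> \<open>In the goal, the exponent \<open>i * l\<close> of the iterate becomes the
    exponent \<open>n * (i * l)\<close> of \<open>f\<close>.\<close>
  unfolding multi_transitive_def nds_comp_iterate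
proof (intro allI impI)
  fix m :: nat and U V :: "nat \<Rightarrow> 'a set"
  assume m: "m \<ge> 1"
    and UV: "\<forall>i\<in>{1..m}. openin T (U i) \<and> U i \<noteq> {} \<and> openin T (V i) \<and> V i \<noteq> {}"
  (* Indices that are not multiples of n get the dummy value 1. *)
  define c where "c j = (if n dvd j then j div n else 1)" for j
  \<comment> \<open>A multiple \<open>n * k\<close> in \<open>{1..m * n}\<close> has
    \<open>k\<close> in \<open>{1..m}\<close>, and the dummy value lies there because
    \<open>m \<ge> 1\<close>.\<close>
  have "c j \<in> {1..m}" if "j \<in> {1..m * n}" for j
    using that m n by (auto simp: c_def elim!: dvdE)
  with UV have "\<forall>j\<in>{1..m * n}. openin T (U (c j)) \<and> U (c j) \<noteq> {} \<and> openin T (V (c j)) \<and> V (c j) \<noteq> {}"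
    by blast
  moreover have "m * n \<ge> 1"
    using m n by simp
  ultimately obtain l where "l \<ge> 1"
    and l: "\<forall>j\<in>{1..m * n}. nds_comp f 1 (j * l) ` U (c j) \<inter> V (c j) \<noteq> {}"
    using assms(1)[unfolded multi_transitive_def, rule_format, of "m * n" "\<lambda>j. U (c j)" "\<lambda>j. V (c j)"]
    by blast
  \<comment> \<open>Only the indices \<open>i * n\<close> matter from here on: their exponent
    \<open>(i * n) * l\<close> equals \<open>n * (i * l)\<close>.\<close>
  have "nds_comp f 1 (n * (i * l)) ` U i \<inter> V i \<noteq> {}" if "i \<in> {1..m}" for i
  proof -
    have "i * n \<in> {1..m * n}" and "c (i * n) = i"
      using that n by (auto simp: c_def)
    with l show ?thesis
      by (metis mult.assoc mult.commute)
  qed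
  with \<open>l \<ge> 1\<close> show "\<exists>l\<ge>1. \<forall>i\<in>{1..m}. nds_comp f 1 (n * (i * l)) ` U i \<inter> V i \<noteq> {}"
    by blast
qed

lemma multi_transitive_nds_iterateD:
  fixes f :: "nat \<Rightarrow> 'a \<Rightarrow> 'a"
  assumes "multi_transitive T (nds_iterate f n)" and n: "n \<ge> 1"
  shows "multi_transitive T f"
  unfolding multi_transitive_def
proof (intro allI impI)
  fix m :: nat and U V :: "nat \<Rightarrow> 'a set"
  assume "m \<ge> 1"
    and "\<forall>i\<in>{1..m}. openin T (U i) \<and> U i \<noteq> {} \<and> openin T (V i) \<and> V i \<noteq> {}"
  then obtain l where "l \<ge> 1" and "\<forall>i\<in>{1..m}. nds_comp f 1 (n * (i * l)) ` U i \<inter> V i \<noteq> {}"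
    using assms(1)[unfolded multi_transitive_def nds_comp_iterate] by blast
  \<comment> \<open>The witness for \<open>f\<close> is \<open>n * l\<close>: the factor
    \<open>n\<close> moves past \<open>i\<close>, so one time serves all the pairs.\<close>
  then have "n * l \<ge> 1" and "\<forall>i\<in>{1..m}. nds_comp f 1 (i * (n * l)) ` U i \<inter> V i \<noteq> {}"
    using n by (simp_all add: mult.left_commute)
  then show "\<exists>l\<ge>1. \<forall>i\<in>{1..m}. nds_comp f 1 (i * l) ` U i \<inter> V i \<noteq> {}"
    by blast
qed

theorem theorem1:
  fixes X :: "'a set" and d :: "'a \<Rightarrow> 'a \<Rightarrow> real"
    and f :: "nat \<Rightarrow> 'a \<Rightarrow> 'a" and n :: nat
  assumes "nds X d f" and "n \<ge> 1"
  shows "multi_transitive (Metric_space.mtopology X d) f \<longleftrightarrow>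
         multi_transitive (Metric_space.mtopology X d) (nds_iterate f n)"
  using assms(2) multi_transitive_nds_iterateI multi_transitive_nds_iterateD by blast

end
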